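(* In misère play restricted to the dicot universe $\mathcal D$, the canonical form of a Hackenbush Sprig is $\ast\!:\!x$, where $x$ is the normal-play value (a number, taken in its canonical form) of the red-blue part of the Sprig.
   Context: Games are finite two-player (Left and Right) partizan game forms $G=\{\mathcal G^L\mid\mathcal G^R\}$, with disjunctive sum $G+H$; $0=\{\cdot\mid\cdot\}$ and $\ast=\{0\mid0\}$. Under normal play a player unable to move on their turn loses; under misère play a player unable to move on their turn wins. $o^-(G)\in\{\mathcal L,\mathcal R,\mathcal N,\mathcal P\}$ denotes the misère-play outcome class of $G$ ($\mathcal L$: Left wins whoever starts; $\mathcal R$: Right wins whoever starts; $\mathcal N$: the player who moves first wins; $\mathcal P$: the player who moves second wins). Outcomes are partially ordered with $\mathcal L$ greatest, $\mathcal R$ least, and $\mathcal N,\mathcal P$ incomparable and strictly between them. A Hackenbush String is a path of coloured edges with one end rooted in the ground; Left moves by cutting a blue or green edge, Right by cutting a red or green edge, and the cut edge together with everything no longer connected to the ground is removed. A (Hackenbush) Sprig is a String whose ground edge is green and whose remaining edges (the red-blue part, itself a red-blue String, possibly empty) are red or blue. In normal play a red-blue String has as value a number. Numbers are dyadic rationals, with canonical forms $0=\{\cdot\mid\cdot\}$; $n=\{n-1\mid\cdot\}$ and $-n=\{\cdot\mid -(n-1)\}$ for positive integers $n$; $\frac{2p+1}{2^q}=\left\{\frac{p}{2^{q-1}}\,\middle|\,\frac{p+1}{2^{q-1}}\right\}$ for integers $p$ and $q\ge 1$. The ordinal sum is $G\!:\!H=\{\mathcal G^L,\,G\!:\!\mathcal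 H^L\mid \mathcal G^R,\,G\!:\!\mathcal H^R\}$. A dicot is a game such that in each of its positions (the game itself and all followers) either both players have an option or neither does; $\mathcal D$ is the class of all dicots. $G\equiv H\pmod{\mathcal D}$ means $o^-(G+X)=o^-(H+X)$ for all $X\in\mathcal D$, and $G\geqq H\pmod{\mathcal D}$ means $o^-(G+X)\ge o^-(H+X)$ for all $X\in\mathcal D$. The canonical form of a game (modulo $\mathcal D$) is the form obtained by eliminating dominated options and bypassing reversible options, in the game and in all of its followers: a Left option $G^{L_1}$ is dominated if $G^{L_2}\geqq G^{L_1}\pmod{\mathcal D}$ for some other Left option $G^{L_2}$; a Left option $G^L$ is reversible if some Right option $G^{LR}$ of it satisfies $G\geqq G^{LR}\pmod{\mathcal D}$ (bypassing it replaces $G^L$ by the Left options of $G^{LR}$); the notions for Right options are symmetric. *)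

theory Defs
  imports Complex_Main "HOL-Library.FSet"
begin

section \<open>Games\<close>

datatype game = Game (lefts: "game fset") (rights: "game fset")

datatype player = Left | Right

fun opponent :: "player \<Rightarrow> player" where
  "opponent Left = Right"
| "opponent Right = Left"

fun options :: "player \<Rightarrow> game \<Rightarrow> game fset" where
  "options Left G = lefts G"
| "options Right G = rights G"

lemma size_left_option: "A |\<in>| lefts G \<Longrightarrow> size A < size G"
proof (cases G)
  case (Game L R)
  assume "A |\<in>| lefts G"
  then have "Suc (size A) \<le> (\<Sum>x \<in> fset L. Suc (size x))"
    using Game by (intro member_le_sum) auto
  then show ?thesis using Game by simp
qed

lemma size_right_option: "A |\<in>| rights G \<Longrightarrow> size A < size G"
proof (cases G)
  case (Game L R)
  assume "A |\<in>| rights G"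
  then have "Suc (size A) \<le> (\<Sum>x \<in> fset R. Suc (size x))"
    using Game by (intro member_le_sum) auto
  then show ?thesis using Game by simp
qed

lemma size_option: "A |\<in>| options p G \<Longrightarrow> size A < size G"
  by (cases p) (auto dest: size_left_option size_right_option)

lemmas [fundef_cong] = fset.map_cong

instantiation game :: "{zero, plus}"
begin

definition zero_game :: game where
  "0 = Game {||} {||}"

text \<open>Disjunctive sum.\<close>

function plus_game :: "game \<Rightarrow> game \<Rightarrow> game" where
  "G + H = Game
     ((\<lambda>G'. G' + H) |`| lefts G |\<union>| (\<lambda>H'. G + H') |`| lefts H)
     ((\<lambda>G'. G' + H) |`| rights G |\<union>| (\<lambda>H'. G + H') |`| rights H)"
  by pat_completeness auto
termination
  by (relation "measure (\<lambda>(G, H). size G + size H)")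
     (auto dest: size_left_option size_right_option)

instance ..

end

declare plus_game.simps [simp del]

definition star :: game where
  "star = Game {|0|} {|0|}"

function ordinal_sum :: "game \<Rightarrow> game \<Rightarrow> game" where
  "ordinal_sum G H = Game
     (lefts G |\<union>| (\<lambda>H'. ordinal_sum G H') |`| lefts H)
     (rights G |\<union>| (\<lambda>H'. ordinal_sum G H') |`| rights H)"
  by pat_completeness auto
termination
  by (relation "measure (\<lambda>(G, H). size H)")
     (auto dest: size_left_option size_right_option)

declare ordinal_sum.simps [simp del]

definition is_option :: "game \<Rightarrow> game \<Rightarrow> bool" where
  "is_option H G \<longleftrightarrow> H |\<in>| lefts G |\<union>| rights G"

text \<open>The positions of a game are the game itself and all of its followers.\<close>

definition positions :: "game \<Rightarrow> game set" where
  "positions G = {H. is_option\<^sup>*\<^sup>* H G}"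

definition dicots :: "game set" where
  "dicots = {G. \<forall>H \<in> positions G. lefts H = {||} \<longleftrightarrow> rights H = {||}}"


section \<open>Outcomes and comparison\<close>

datatype convention = Normal | Misere

function wins_first :: "convention \<Rightarrow> player \<Rightarrow> game \<Rightarrow> bool" where
  "wins_first c p G \<longleftrightarrow>
     (if options p G = {||} then c = Misere
      else \<exists>H |\<in>| options p G. \<not> wins_first c (opponent p) H)"
  by pat_completeness auto
termination
  by (relation "measure (\<lambda>(c, p, G). size G)") (auto dest: size_option)

declare wins_first.simps [simp del]

datatype outcome_class = L_class | R_class | N_class | P_class

definition outcome :: "convention \<Rightarrow> game \<Rightarrow> outcome_class" where
  "outcome c G =
     (if wins_first c Left G
      then (if wins_first c Right G then N_class else L_class)
      else (if wins_first c Right G then R_class else P_class))"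

instantiation outcome_class :: order
begin

definition less_eq_outcome_class :: "outcome_class \<Rightarrow> outcome_class \<Rightarrow> bool" where
  "a \<le> b \<longleftrightarrow> a = b \<or> a = R_class \<or> b = L_class"

definition less_outcome_class :: "outcome_class \<Rightarrow> outcome_class \<Rightarrow> bool" where
  "a < b \<longleftrightarrow> a \<le> b \<and> a \<noteq> (b :: outcome_class)"

instance
  by standard (auto simp: less_eq_outcome_class_def less_outcome_class_def)

end

definition ge_mod :: "convention \<Rightarrow> game set \<Rightarrow> game \<Rightarrow> game \<Rightarrow> bool" where
  "ge_mod c U G H \<longleftrightarrow> (\<forall>X \<in> U. outcome c (G + X) \<ge> outcome c (H + X))"

definition equiv_mod :: "convention \<Rightarrow> game set \<Rightarrow> game \<Rightarrow> game \<Rightarrow> bool" where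
  "equiv_mod c U G H \<longleftrightarrow> (\<forall>X \<in> U. outcome c (G + X) = outcome c (H + X))"

abbreviation ge_dicot :: "game \<Rightarrow> game \<Rightarrow> bool" where
  "ge_dicot \<equiv> ge_mod Misere dicots"

abbreviation equal_normal :: "game \<Rightarrow> game \<Rightarrow> bool" where
  "equal_normal \<equiv> equiv_mod Normal UNIV"


section \<open>Canonical form modulo the dicots\<close>

text \<open>One simplification step, in the game itself or in one of its followers.  Options form
  sets, so a step on an option may merge it with another option.\<close>

inductive simplifies :: "game \<Rightarrow> game \<Rightarrow> bool" where
  dominated_left:
    "A |\<in>| L \<Longrightarrow> B |\<in>| L \<Longrightarrow> B \<noteq> A \<Longrightarrow> ge_dicot B A \<Longrightarrow>
     simplifies (Game L R) (Game (L |-| {|A|}) R)"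
| dominated_right:
    "A |\<in>| R \<Longrightarrow> B |\<in>| R \<Longrightarrow> B \<noteq> A \<Longrightarrow> ge_dicot A B \<Longrightarrow>
     simplifies (Game L R) (Game L (R |-| {|A|}))"
| reversible_left:
    "A |\<in>| L \<Longrightarrow> A' |\<in>| rights A \<Longrightarrow> ge_dicot (Game L R) A' \<Longrightarrow>
     simplifies (Game L R) (Game ((L |-| {|A|}) |\<union>| lefts A') R)"
| reversible_right:
    "A |\<in>| R \<Longrightarrow> A' |\<in>| lefts A \<Longrightarrow> ge_dicot A' (Game L R) \<Longrightarrow>
     simplifies (Game L R) (Game L ((R |-| {|A|}) |\<union>| rights A'))"
| follower_left:
    "A |\<in>| L \<Longrightarrow> simplifies A B \<Longrightarrow>
     simplifies (Game L R) (Game (finsert B (L |-| {|A|})) R)"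
| follower_right:
    "A |\<in>| R \<Longrightarrow> simplifies A B \<Longrightarrow>
     simplifies (Game L R) (Game L (finsert B (R |-| {|A|})))"

definition canonical_form :: "game \<Rightarrow> game \<Rightarrow> bool" where
  "canonical_form G K \<longleftrightarrow> simplifies\<^sup>*\<^sup>* G K \<and> (\<nexists>K'. simplifies K K')"


section \<open>Numbers\<close>

text \<open>\<open>number_form x X\<close>: the number \<open>x\<close> is a dyadic rational with canonical form \<open>X\<close>.\<close>

inductive number_form :: "rat \<Rightarrow> game \<Rightarrow> bool" where
  "number_form 0 0"
| "number_form (of_nat n) A \<Longrightarrow> number_form (of_nat (Suc n)) (Game {|A|} {||})"
| "number_form (- of_nat n) A \<Longrightarrow> number_form (- of_nat (Suc n)) (Game {||} {|A|})"
| "number_form (of_int p / 2 ^ q) A \<Longrightarrow> number_form (of_int (p + 1) / 2 ^ q) B \<Longrightarrow>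
     number_form (of_int (2 * p + 1) / 2 ^ Suc q) (Game {|A|} {|B|})"

definition normal_value :: "game \<Rightarrow> rat \<Rightarrow> bool" where
  "normal_value G x \<longleftrightarrow> (\<exists>X. number_form x X \<and> equal_normal G X)"


section \<open>Hackenbush Strings\<close>

datatype colour = Blue | Red | Green

text \<open>A String is the list of its edges, the ground edge first.  Cutting the edge at index \<open>i\<close>
  leaves the \<open>i\<close> edges below it.\<close>

function string_game :: "colour list \<Rightarrow> game" where
  "string_game s = Game
     (fset_of_list (map (\<lambda>i. string_game (take i s)) (filter (\<lambda>i. s ! i \<in> {Blue, Green}) [0..<length s])))
     (fset_of_list (map (\<lambda>i. string_game (take i s)) (filter (\<lambda>i. s ! i \<in> {Red, Green}) [0..<length s])))"
  by pat_completeness auto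
termination
  by (relation "measure length") auto

declare string_game.simps [simp del]

definition red_blue :: "colour list \<Rightarrow> bool" where
  "red_blue s \<longleftrightarrow> set s \<subseteq> {Red, Blue}"

definition sprig :: "colour list \<Rightarrow> bool" where
  "sprig s \<longleftrightarrow> (\<exists>t. s = Green # t \<and> red_blue t)"

definition red_blue_part :: "colour list \<Rightarrow> colour list" where
  "red_blue_part s = tl s"

end

theory Submission
  imports Defs
begin

text \<open>
  Write \<open>*:T\<close> for the ordinal sum of \<open>*\<close> and any game \<open>T\<close>; below it is called a sprout.  A Sprig is the
  sprout of its red-blue part, because an ordinal sum glues Strings together.  The theorem holds
  because comparison of sprouts modulo the dicots is the same as comparison in normal play of the
  games on top:

    \<open>*:T \<ge> *:U\<close> modulo the dicots if and only if \<open>T \<ge> U\<close> in normal play.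

  From right to left this is the colon principle, which survives the passage to misere play because
  a sprout, having \<open>0\<close> as an option for both players, never stops a player from moving
  (\<open>colon_principle\<close>).  From left to right, add to both sides the dicot \<open>*:(-U) + trap\<close>.  The trap is
  built so that, in a sum \<open>*:A + *:B + trap\<close>, whoever first cuts a green edge or moves in the trap
  loses; the player who runs out of moves in \<open>A + B\<close> is forced to do so, hence the misere winner of
  that sum is the normal-play winner of \<open>A + B\<close> (\<open>misere_sprouts_trap\<close>).

  The extra option \<open>0\<close> of a sprout is inert: adding \<open>*\<close> shows that \<open>0\<close> is incomparable with every
  sprout, so it neither dominates nor is dominated, and no option reverses through it.  Therefore
  a simplification step on \<open>*:T\<close> is a normal-play simplification step on \<open>T\<close> under the same green edge,
  and it keeps the normal-play value (\<open>simplifies_sprout\<close>), and the uniqueness argument for normal-play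
  canonical forms shows that equivalent \<open>T\<close> and \<open>U\<close> with irreducible sprouts are equal
  (\<open>irreducible_sprouts_eq\<close>).  Simplification terminates, so the canonical form of \<open>*:T\<close> is \<open>*:X\<close>
  as soon as \<open>X\<close> is equivalent to \<open>T\<close> and \<open>*:X\<close> is irreducible (\<open>canonical_form_sprout\<close>).

  It remains to see that canonical forms of numbers are irreducible (\<open>number_form_irreducible\<close>) and
  that a red-blue String equals a number (\<open>red_blue_string_number\<close>).  For the latter, a new top edge
  of a String with value \<open>X\<close> adds \<open>X\<close> itself as the best option of the edge's owner, and replacing
  that player's options of the canonical form of a number by the number itself again gives a
  canonical form.

  The two players are treated at once: notions are indexed by a player \<open>p\<close>, and the preference of
  the opponent is the converse of the preference of \<open>p\<close>.
\<close>

section \<open>Players, options and sprouts\<close>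

lemma opponent_opponent [simp]: "opponent (opponent p) = p"
  by (cases p) auto

lemma opponent_neq [simp]: "opponent p \<noteq> p" "p \<noteq> opponent p"
  by (cases p; simp)+

lemma all_player: "(\<forall>p. Q p) \<longleftrightarrow> Q Left \<and> Q Right"
  by (metis player.exhaust)

lemma ex_player: "(\<exists>p. Q p) \<longleftrightarrow> Q Left \<or> Q Right"
  by (metis player.exhaust)

lemma game_eqI: "(\<And>p. options p G = options p H) \<Longrightarrow> G = H"
  by (metis game.expand options.simps)

fun replace_opts :: "player \<Rightarrow> game fset \<Rightarrow> game \<Rightarrow> game" where
  "replace_opts Left S G = Game S (rights G)"
| "replace_opts Right S G = Game (lefts G) S"

lemma options_replace_opts [simp]:
  "options q (replace_opts p S G) = (if q = p then S else options q G)"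
  by (cases p; cases q) auto

lemma options_zero [simp]: "options p 0 = {||}"
  by (cases p) (auto simp: zero_game_def)

lemma options_star [simp]: "options p star = {|0|}"
  by (cases p) (auto simp: star_def)

lemma options_plus:
  "options p (G + H) = (\<lambda>G'. G' + H) |`| options p G |\<union>| (\<lambda>H'. G + H') |`| options p H"
  by (cases p) (auto simp: plus_game.simps[of G H])

lemma options_ordinal_sum:
  "options p (ordinal_sum G H) = options p G |\<union>| ordinal_sum G |`| options p H"
  by (cases p) (auto simp: ordinal_sum.simps[of G H])

lemma game_induct [case_names options]:
  assumes "\<And>G. (\<And>p A. A |\<in>| options p G \<Longrightarrow> P A) \<Longrightarrow> P G"
  shows "P G"
  by (induction G rule: measure_induct_rule[of size]) (auto intro: assms dest: size_option)

lemma zero_plus [simp]: "0 + G = (G :: game)"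
proof (induction G rule: game_induct)
  case (options G)
  have "options p (0 + G) = options p G" for p
    using options[of _ p] by (auto simp: options_plus fimage_iff intro: fset_eqI)
  then show ?case by (intro game_eqI)
qed

lemma plus_zero [simp]: "G + 0 = (G :: game)"
proof (induction G rule: game_induct)
  case (options G)
  have "options p (G + 0) = options p G" for p
    using options[of _ p] by (auto simp: options_plus fimage_iff intro: fset_eqI)
  then show ?case by (intro game_eqI)
qed

text \<open>This makes the colon principle for the base \<open>0\<close> a statement about disjunctive sums in normal play.\<close>

lemma zero_ordinal_sum [simp]: "ordinal_sum 0 G = G"
proof (induction G rule: game_induct)
  case (options G)
  have "options p (ordinal_sum 0 G) = options p G" for p
    using options[of _ p] by (auto simp: options_ordinal_sum fimage_iff intro: fset_eqI)
  then show ?case by (intro game_eqI)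
qed

lemma wins_first_iff:
  "wins_first c p G \<longleftrightarrow>
     (options p G = {||} \<and> c = Misere) \<or> (\<exists>A |\<in>| options p G. \<not> wins_first c (opponent p) A)"
  by (subst wins_first.simps) auto

lemma wins_firstI:
  "A |\<in>| options p G \<Longrightarrow> \<not> wins_first c (opponent p) A \<Longrightarrow> wins_first c p G"
  by (subst wins_first_iff) auto

lemma plus_optionI1: "A |\<in>| options p G \<Longrightarrow> A + H |\<in>| options p (G + H)"
  by (auto simp: options_plus)

lemma plus_optionE:
  assumes "C |\<in>| options p (G + H)"
  obtains A where "A |\<in>| options p G" "C = A + H" | B where "B |\<in>| options p H" "C = G + B"
  using assms by (auto simp: options_plus)

abbreviation sprout :: "game \<Rightarrow> game" where
  "sprout \<equiv> ordinal_sum star"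

lemma options_sprout: "options p (sprout T) = finsert 0 (sprout |`| options p T)"
  by (simp add: options_ordinal_sum)

lemma sprout_neq_zero [simp]: "sprout T \<noteq> 0" "0 \<noteq> sprout T"
  using options_sprout[of Left T] options_zero[of Left] by force+

lemma sprout_inject [simp]: "sprout T = sprout U \<longleftrightarrow> T = U"
proof
  assume "sprout T = sprout U"
  then show "T = U"
  proof (induction T arbitrary: U rule: game_induct)
    case (options T)
    show ?case
    proof (rule game_eqI)
      fix p
      have "finsert 0 (sprout |`| options p T) = finsert 0 (sprout |`| options p U)"
        using options.prems by (metis options_sprout)
      moreover have "0 |\<notin>| sprout |`| S" for S
        by auto
      ultimately have *: "sprout |`| options p T = sprout |`| options p U"
        by (metis finsert_ident)
      show "options p T = options p U"
      proof (rule fset_eqI)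
        fix A
        show "A |\<in>| options p T \<longleftrightarrow> A |\<in>| options p U"
          using * options.IH by (smt (verit) fimageE fimageI)
      qed
    qed
  qed
qed simp

section \<open>Comparison in normal play\<close>

text \<open>Player \<open>p\<close> prefers \<open>T\<close> to \<open>U\<close> in normal play: \<open>T \<ge> U\<close> for Left and \<open>T \<le> U\<close> for Right, by Conway's
  recursion.\<close>

function prefers :: "player \<Rightarrow> game \<Rightarrow> game \<Rightarrow> bool" where
  "prefers p T U \<longleftrightarrow>
     (\<forall>U' |\<in>| options p U. \<not> prefers p U' T) \<and> (\<forall>T' |\<in>| options (opponent p) T. \<not> prefers p U T')"
  by pat_completeness auto
termination
  by (relation "measure (\<lambda>(p, T, U). size T + size U)") (auto dest: size_option)

declare prefers.simps [simp del]

lemma prefers_opponent [simp]: "prefers (opponent p) T U \<longleftrightarrow> prefers p U T"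
proof (induction "size T + size U" arbitrary: T U rule: less_induct)
  case less
  have 1: "prefers (opponent p) U' T \<longleftrightarrow> prefers p T U'" if "U' |\<in>| options q U" for U' q
    using less[of U' T] size_option[OF that] by simp
  have 2: "prefers (opponent p) U T' \<longleftrightarrow> prefers p T' U" if "T' |\<in>| options q T" for T' q
    using less[of U T'] size_option[OF that] by simp
  show ?case
    unfolding prefers.simps[of "opponent p" T U] prefers.simps[of p U T]
    using 1 2 by auto
qed

lemma prefers_refl [simp]: "prefers p T T"
proof (induction T rule: game_induct)
  case (options T)
  have "\<not> prefers p A T" if "A |\<in>| options p T" for A
    using options[OF that] that by (auto simp: prefers.simps[of p A T])
  moreover have "\<not> prefers p T A" if "A |\<in>| options (opponent p) T" for A
    using options[OF that] that by (auto simp: prefers.simps[of p T A])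
  ultimately show ?case
    by (subst prefers.simps) auto
qed

lemma not_prefers_own_option: "A |\<in>| options p T \<Longrightarrow> \<not> prefers p A T"
  and not_prefers_opponent_option: "A |\<in>| options (opponent p) T \<Longrightarrow> \<not> prefers p T A"
  using prefers_refl[of p T] unfolding prefers.simps[of p T T] by blast+

primrec neg :: "game \<Rightarrow> game" where
  "neg (Game L R) = Game (neg |`| R) (neg |`| L)"

lemma options_neg: "options p (neg G) = neg |`| options (opponent p) G"
  by (cases G; cases p) auto

text \<open>The recursion for \<open>prefers\<close> unfolds exactly like play in a difference: a move of \<open>p\<close> in \<open>A - B\<close> is a
  move of \<open>p\<close> in \<open>A\<close> or, mirrored, a move of the opponent in \<open>B\<close>.\<close>

lemma wins_first_difference:
  "wins_first Normal p (A + neg B) \<longleftrightarrow> \<not> prefers p B A"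
proof (induction "size A + size B" arbitrary: A B p rule: less_induct)
  case less
  have 1: "wins_first Normal (opponent p) (A' + neg B) \<longleftrightarrow> \<not> prefers p A' B"
    if "A' |\<in>| options p A" for A'
    using less[of A' B] size_option[OF that] by simp
  have 2: "wins_first Normal (opponent p) (A + neg B') \<longleftrightarrow> \<not> prefers p A B'"
    if "B' |\<in>| options (opponent p) B" for B'
    using less[of A B'] size_option[OF that] by simp
  show ?case
    unfolding wins_first_iff[of _ _ "A + neg B"] prefers.simps[of p B A]
    using 1 2 by (auto simp: options_plus options_neg)
qed

text \<open>The player-indexed form of \<open>ge_mod\<close>, with outcomes resolved into who wins when moving first.\<close>

definition mod_prefers :: "convention \<Rightarrow> game set \<Rightarrow> player \<Rightarrow> game \<Rightarrow> game \<Rightarrow> bool" where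
  "mod_prefers c \<U> p G H \<longleftrightarrow>
     (\<forall>X \<in> \<U>. (wins_first c p (H + X) \<longrightarrow> wins_first c p (G + X)) \<and>
       (wins_first c (opponent p) (G + X) \<longrightarrow> wins_first c (opponent p) (H + X)))"

lemma mod_prefers_opponent: "mod_prefers c \<U> (opponent p) G H \<longleftrightarrow> mod_prefers c \<U> p H G"
  by (auto simp: mod_prefers_def)

lemma ge_mod_iff: "ge_mod c \<U> G H \<longleftrightarrow> mod_prefers c \<U> Left G H"
  unfolding ge_mod_def mod_prefers_def
  by (intro ball_cong refl) (auto simp: outcome_def less_eq_outcome_class_def)

lemma equiv_mod_iff: "equiv_mod c \<U> G H \<longleftrightarrow> (\<forall>p. mod_prefers c \<U> p G H)"
proof -
  have "equiv_mod c \<U> G H \<longleftrightarrow> ge_mod c \<U> G H \<and> ge_mod c \<U> H G"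
    unfolding equiv_mod_def ge_mod_def by (metis order_antisym order_refl)
  then show ?thesis
    using mod_prefers_opponent[of c \<U> Left G H] by (simp add: ge_mod_iff all_player)
qed

text \<open>The player \<open>p\<close> carries a winning strategy over from \<open>G:U + X\<close> to \<open>G:T + X\<close> by copying it.  A move to
  an option \<open>U'\<close> of \<open>U\<close> cannot be copied literally; but \<open>U'\<close> is not preferred to \<open>T\<close>, so either \<open>T\<close>
  has an option at least as good as \<open>U'\<close>, or \<open>U'\<close> allows the opponent a reply \<open>U''\<close> that is no better for
  \<open>p\<close> than \<open>T\<close>.  In the second case \<open>p\<close> wins moving first after that reply, and this win carries over to \<open>T\<close>.  The hypothesis excludes that \<open>p\<close> wins
  \<open>G:U + X\<close> in misere play merely by being unable to move.\<close>

lemma colon_principle: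
  assumes "c = Normal \<or> (\<forall>p. options p G \<noteq> {||})"
  shows "prefers p T U \<Longrightarrow> wins_first c p (ordinal_sum G U + X) \<Longrightarrow>
    wins_first c p (ordinal_sum G T + X)"
proof (induction "size T + size U + size X" arbitrary: p T U X rule: less_induct)
  case less
  have "\<not> (options p (ordinal_sum G U + X) = {||} \<and> c = Misere)"
    using assms by (auto simp: options_plus options_ordinal_sum)
  with less.prems(2) obtain C where C: "C |\<in>| options p (ordinal_sum G U + X)"
    "\<not> wins_first c (opponent p) C"
    by (auto simp: wins_first_iff[of c p])
  from C(1) consider
      (base) A where "A |\<in>| options p G" "C = A + X"
    | (top) U' where "U' |\<in>| options p U" "C = ordinal_sum G U' + X"
    | (side) X' where "X' |\<in>| options p X" "C = ordinal_sum G U + X'"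
    by (auto simp: options_plus options_ordinal_sum)
  then show ?case
  proof cases
    case base
    then show ?thesis
      using C(2) by (intro wins_firstI[of C]) (auto simp: options_plus options_ordinal_sum)
  next
    case (top U')
    have "\<not> prefers p U' T"
      using less.prems(1) top(1) by (auto simp: prefers.simps[of p T U])
    then consider (dominates) T' where "T' |\<in>| options p T" "prefers p T' U'"
      | (reverses) U'' where "U'' |\<in>| options (opponent p) U'" "prefers p T U''"
      by (auto simp: prefers.simps[of p U' T])
    then show ?thesis
    proof cases
      case (dominates T')
      \<comment> \<open>The opponent's preference is the converse one, so the induction hypothesis transfers
        a win of the opponent from \<open>T'\<close> to \<open>U'\<close>.\<close>
      have "\<not> wins_first c (opponent p) (ordinal_sum G T' + X)"
        using less.hyps[of U' T' X "opponent p"] dominates C(2) top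
          size_option[OF dominates(1)] size_option[OF top(1)] by auto
      then show ?thesis
        using dominates(1)
        by (intro wins_firstI[of "ordinal_sum G T' + X"]) (auto simp: options_plus options_ordinal_sum)
    next
      case (reverses U'')
      have "ordinal_sum G U'' + X |\<in>| options (opponent p) C"
        using reverses(1) top(2) by (auto simp: options_plus options_ordinal_sum)
      then have "wins_first c p (ordinal_sum G U'' + X)"
        using C(2) wins_firstI by fastforce
      then show ?thesis
        using less.hyps[of T U'' X p] reverses(2) size_option[OF reverses(1)] size_option[OF top(1)]
        by simp
    qed
  next
    case (side X')
    have "\<not> wins_first c (opponent p) (ordinal_sum G T + X')"
      using less.hyps[of U T X' "opponent p"] less.prems(1) C(2) side size_option[OF side(1)] by auto
    then show ?thesis
      using side(1) by (intro wins_firstI[of "ordinal_sum G T + X'"]) (auto simp: options_plus)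
  qed
qed

lemma colon_principle_mod:
  assumes "c = Normal \<or> (\<forall>p. options p G \<noteq> {||})" "prefers p T U"
  shows "mod_prefers c \<U> p (ordinal_sum G T) (ordinal_sum G U)"
  using colon_principle[OF assms(1), of p T U] colon_principle[OF assms(1), of "opponent p" U T] assms(2)
  by (auto simp: mod_prefers_def)

text \<open>The colon principle over \<open>0\<close> gives one direction; the test game \<open>-U\<close> gives the other, because
  \<open>U - U\<close> is lost by whoever moves first.\<close>

lemma prefers_iff_mod_prefers: "prefers p T U \<longleftrightarrow> mod_prefers Normal UNIV p T U"
proof
  show "prefers p T U \<Longrightarrow> mod_prefers Normal UNIV p T U"
    using colon_principle_mod[of Normal 0] by simp
  assume "mod_prefers Normal UNIV p T U"
  then have "wins_first Normal (opponent p) (T + neg U) \<Longrightarrow> wins_first Normal (opponent p) (U + neg U)"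
    by (auto simp: mod_prefers_def)
  then show "prefers p T U"
    by (simp add: wins_first_difference) blast
qed

lemma prefers_trans: "prefers p T U \<Longrightarrow> prefers p U V \<Longrightarrow> prefers p T V"
  by (simp add: prefers_iff_mod_prefers mod_prefers_def)

section \<open>A test game that turns misere play into normal play\<close>

text \<open>The sprouts of the numbers \<open>1\<close> (for Left) and \<open>-1\<close> (for Right): Hackenbush Sprigs with one edge of
  the colour of \<open>p\<close> on top of the green one.\<close>

definition twig :: "player \<Rightarrow> game" where
  "twig p = sprout (replace_opts p {|0|} 0)"

text \<open>A move in the trap hands the opponent two of their own twigs, which suffice to beat the mover even in
  the presence of two arbitrary sprouts.\<close>

definition trap :: game where
  "trap = Game {|twig Right + twig Right|} {|twig Left + twig Left|}"

lemma options_trap: "options p trap = {|twig (opponent p) + twig (opponent p)|}"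
  by (cases p) (auto simp: trap_def)

lemma sprout_zero [simp]: "sprout 0 = star"
  by (rule game_eqI) (simp add: options_sprout)

lemma options_twig: "options p (twig p) = {|0, star|}" "options (opponent p) (twig p) = {|0|}"
  by (simp_all add: twig_def options_sprout)

lemma misere_zero: "wins_first Misere p 0"
  by (subst wins_first_iff) simp

lemma misere_star: "\<not> wins_first Misere p star"
  by (subst wins_first_iff) (simp add: misere_zero)

text \<open>Used with a sprout as \<open>G\<close>: cutting its green edge discards it, so the sprout serves to pass the move.\<close>

lemma misere_cut:
  "0 |\<in>| options p G \<Longrightarrow> \<not> wins_first Misere (opponent p) X \<Longrightarrow> wins_first Misere p (G + X)"
  by (rule wins_firstI[of X]) (force simp: options_plus)+

lemma zero_option_sprout [simp]: "0 |\<in>| options p (sprout T)"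
  by (simp add: options_sprout)

lemma misere_twig: "\<not> wins_first Misere (opponent p) (twig p)"
  by (subst wins_first_iff) (simp add: options_twig misere_zero)

lemma zero_option_twig [simp]: "0 |\<in>| options q (twig p)"
  by (simp add: twig_def)

lemma misere_two_twigs: "\<not> wins_first Misere (opponent p) (twig p + twig p)"
proof -
  have "options (opponent p) (twig p + twig p) = {|twig p|}"
    by (simp add: options_plus options_twig)
  moreover have "wins_first Misere p (twig p)"
    by (rule wins_firstI[of star]) (simp_all add: options_twig misere_star)
  ultimately show ?thesis
    by (subst wins_first_iff) simp
qed

text \<open>If the opponent of \<open>p\<close> cuts a green edge, then \<open>p\<close> cuts another and leaves one twig of \<open>p\<close>.  If the
  opponent moves higher up in \<open>B\<close>, then \<open>p\<close> cuts what remains of \<open>B\<close> and keeps both twigs.\<close>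

lemma misere_sprout_two_twigs: "\<not> wins_first Misere (opponent p) (sprout B + (twig p + twig p))"
proof
  assume "wins_first Misere (opponent p) (sprout B + (twig p + twig p))"
  moreover have "0 + (twig p + twig p) |\<in>| options (opponent p) (sprout B + (twig p + twig p))"
    by (intro plus_optionI1) simp
  ultimately obtain C where C: "C |\<in>| options (opponent p) (sprout B + (twig p + twig p))"
    "\<not> wins_first Misere p C"
    by (auto simp: wins_first_iff[of _ "opponent p"])
  then consider "C = twig p + twig p" | B' where "C = sprout B' + (twig p + twig p)"
    | "C = sprout B + twig p"
    by (auto simp: options_plus options_sprout options_twig)
  then have "wins_first Misere p C"
    by cases (auto intro!: misere_cut misere_twig misere_two_twigs)
  with C(2) show False ..
qed

lemma misere_trap: "\<not> wins_first Misere p trap"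
  using misere_twig[of "opponent p"] by (subst wins_first_iff) (simp add: options_trap misere_cut)

text \<open>Cutting a green edge loses, since the opponent then cuts the other one and leaves only the trap,
  in which the mover must give away two twigs.  Moving in the trap loses, since the opponent
  cuts \<open>A\<close> and keeps the two twigs.  So a player moves in \<open>A\<close> and \<open>B\<close> as long as possible, and one who
  cannot is forced into a losing move, as in normal play.\<close>

lemma misere_sprouts_trap:
  "wins_first Misere p (sprout A + (sprout B + trap)) \<longleftrightarrow> wins_first Normal p (A + B)"
proof (induction "size A + size B" arbitrary: A B p rule: less_induct)
  case less
  have 1: "wins_first Misere q (sprout A' + (sprout B + trap)) \<longleftrightarrow> wins_first Normal q (A' + B)"
    if "A' |\<in>| options p A" for A' q
    using less size_option[OF that] by simp
  have 2: "wins_first Misere q (sprout A + (sprout B' + trap)) \<longleftrightarrow> wins_first Normal q (A + B')"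
    if "B' |\<in>| options p B" for B' q
    using less size_option[OF that] by simp
  have cut: "wins_first Misere q (sprout C + trap)" for q C
    by (simp add: misere_cut misere_trap)
  have trapped: "wins_first Misere q (sprout A + (sprout B + (twig q + twig q)))" for q
    by (simp add: misere_cut misere_sprout_two_twigs)
  have "wins_first Misere p (sprout A + (sprout B + trap)) \<longleftrightarrow>
      (\<exists>A' |\<in>| options p A. \<not> wins_first Misere (opponent p) (sprout A' + (sprout B + trap))) \<or>
      (\<exists>B' |\<in>| options p B. \<not> wins_first Misere (opponent p) (sprout A + (sprout B' + trap)))"
    using cut[of "opponent p"] trapped[of "opponent p"]
    by (simp add: wins_first_iff[of _ p] options_plus options_sprout options_trap bex_Un)
  also have "\<dots> \<longleftrightarrow> wins_first Normal p (A + B)"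
    using 1 2 by (simp add: wins_first_iff[of _ p] options_plus bex_Un)
  finally show ?case .
qed

section \<open>Comparing sprouts modulo the dicots\<close>

lemma dicot_iff:
  "G \<in> dicots \<longleftrightarrow> (lefts G = {||} \<longleftrightarrow> rights G = {||}) \<and> (\<forall>p. \<forall>A |\<in>| options p G. A \<in> dicots)"
proof -
  have opt: "is_option A G \<longleftrightarrow> (\<exists>p. A |\<in>| options p G)" for A
    by (simp add: is_option_def ex_player)
  have "is_option\<^sup>*\<^sup>* H G \<longleftrightarrow> H = G \<or> (\<exists>A. is_option A G \<and> is_option\<^sup>*\<^sup>* H A)" for H
    by (metis rtranclp.simps)
  then have "positions G = insert G (\<Union>A \<in> {A. is_option A G}. positions A)"
    by (auto simp: positions_def)
  then have "G \<in> dicots \<longleftrightarrow> (\<forall>H \<in> insert G (\<Union>A \<in> {A. is_option A G}. positions A).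
      lefts H = {||} \<longleftrightarrow> rights H = {||})"
    by (simp add: dicots_def)
  also have "\<dots> \<longleftrightarrow> (lefts G = {||} \<longleftrightarrow> rights G = {||}) \<and> (\<forall>A. is_option A G \<longrightarrow> A \<in> dicots)"
    unfolding dicots_def by blast
  finally show ?thesis
    using opt by auto
qed

lemma dicot_sprout: "sprout T \<in> dicots"
proof (induction T rule: game_induct)
  case (options T)
  have "0 \<in> dicots"
    by (subst dicot_iff) (simp, simp add: zero_game_def)
  moreover have "lefts (sprout T) \<noteq> {||}" "rights (sprout T) \<noteq> {||}"
    using zero_option_sprout[of Left T] zero_option_sprout[of Right T] by auto
  ultimately show ?case
    using options by (subst dicot_iff) (auto simp: options_sprout)
qed

lemma dicot_plus: "G \<in> dicots \<Longrightarrow> H \<in> dicots \<Longrightarrow> G + H \<in> dicots"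
proof (induction "size G + size H" arbitrary: G H rule: less_induct)
  case less
  have "lefts (G + H) = {||} \<longleftrightarrow> rights (G + H) = {||}"
    using less.prems options_plus[of Left G H] options_plus[of Right G H]
    by (auto simp: dicot_iff[of G] dicot_iff[of H])
  moreover have "C \<in> dicots" if "C |\<in>| options p (G + H)" for p C
    using that
  proof (cases rule: plus_optionE)
    case (1 A)
    then show ?thesis
      using less.hyps[of A H] less.prems size_option[of A p G] by (auto simp: dicot_iff[of G])
  next
    case (2 B)
    then show ?thesis
      using less.hyps[of G B] less.prems size_option[of B p H] by (auto simp: dicot_iff[of H])
  qed
  ultimately show ?case
    by (subst dicot_iff) auto
qed

lemma dicot_trap: "trap \<in> dicots"
  by (subst dicot_iff) (simp add: options_trap twig_def dicot_plus dicot_sprout, simp add: trap_def)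

abbreviation dicot_prefers :: "player \<Rightarrow> game \<Rightarrow> game \<Rightarrow> bool" where
  "dicot_prefers \<equiv> mod_prefers Misere dicots"

theorem dicot_prefers_sprout_iff: "dicot_prefers p (sprout T) (sprout U) \<longleftrightarrow> prefers p T U"
proof
  show "prefers p T U \<Longrightarrow> dicot_prefers p (sprout T) (sprout U)"
    by (rule colon_principle_mod) auto
  assume "dicot_prefers p (sprout T) (sprout U)"
  moreover have "sprout (neg U) + trap \<in> dicots"
    by (intro dicot_plus dicot_sprout dicot_trap)
  ultimately have "wins_first Normal (opponent p) (T + neg U) \<Longrightarrow> wins_first Normal (opponent p) (U + neg U)"
    by (simp add: mod_prefers_def flip: misere_sprouts_trap)
  then show "prefers p T U"
    by (simp add: wins_first_difference) blast
qed

text \<open>Adding \<open>*\<close> separates them: in \<open>*:T + *\<close> the first player wins by cutting the green edge of the sprout,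
  whereas \<open>0 + *\<close> is lost by the first player.\<close>

lemma sprout_zero_incomparable:
  "\<not> dicot_prefers p (sprout T) 0" "\<not> dicot_prefers p 0 (sprout T)"
proof -
  have "wins_first Misere q (sprout T + star)" for q
    by (simp add: misere_cut misere_star)
  moreover have "star \<in> dicots"
    using dicot_sprout[of 0] by simp
  ultimately show "\<not> dicot_prefers p (sprout T) 0" "\<not> dicot_prefers p 0 (sprout T)"
    using misere_star by (auto simp: mod_prefers_def intro!: bexI[of _ star])
qed

section \<open>Simplifying sprouts\<close>

text \<open>All six rules in one equivalence that treats the players alike.\<close>

lemma simplifies_iff:
  "simplifies G K \<longleftrightarrow> (\<exists>p A. A |\<in>| options p G \<and>
     ((\<exists>B. B |\<in>| options p G \<and> B \<noteq> A \<and> dicot_prefers p B A \<and>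
         K = replace_opts p (options p G |-| {|A|}) G) \<or>
      (\<exists>C. C |\<in>| options (opponent p) A \<and> dicot_prefers p G C \<and>
         K = replace_opts p ((options p G |-| {|A|}) |\<union>| options p C) G) \<or>
      (\<exists>B. simplifies A B \<and> K = replace_opts p (finsert B (options p G |-| {|A|})) G)))"
  (is "_ \<longleftrightarrow> (\<exists>p A. ?step p A)")
proof -
  have right: "dicot_prefers Right H H' \<longleftrightarrow> ge_dicot H' H" for H H'
    using mod_prefers_opponent[of Misere dicots Left H H'] by (simp add: ge_mod_iff)
  show ?thesis
  proof
    assume "simplifies G K"
    then show "\<exists>p A. ?step p A"
    proof cases
      case (dominated_left A L B R)
      then show ?thesis
        by (intro exI[of _ Left] exI[of _ A]) (auto simp flip: ge_mod_iff)
    next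
      case (dominated_right A R B L)
      then show ?thesis
        by (intro exI[of _ Right] exI[of _ A]) (auto simp: right)
    next
      case (reversible_left A L A' R)
      then show ?thesis
        by (intro exI[of _ Left] exI[of _ A]) (auto simp flip: ge_mod_iff)
    next
      case (reversible_right A R A' L)
      then show ?thesis
        by (intro exI[of _ Right] exI[of _ A]) (auto simp: right)
    next
      case (follower_left A L B R)
      then show ?thesis
        by (intro exI[of _ Left] exI[of _ A]) auto
    next
      case (follower_right A R B L)
      then show ?thesis
        by (intro exI[of _ Right] exI[of _ A]) auto
    qed
  next
    assume "\<exists>p A. ?step p A"
    then obtain p A where "?step p A"
      by blast
    then show "simplifies G K"
      by (cases G; cases p) (auto simp: right simp flip: ge_mod_iff intro: simplifies.intros)
  qed
qed

text \<open>A step replaces one option by options that weigh less in total: none, the options of a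
  smaller game, or a simpler follower.\<close>

definition weight :: "game fset \<Rightarrow> nat" where
  "weight S = (\<Sum>A \<in> fset S. Suc (size A))"

lemma size_replace_opts:
  "size (replace_opts p S G) + weight (options p G) = size G + weight S"
  by (cases G; cases p) (auto simp: weight_def)

lemma weight_remove: "A |\<in>| S \<Longrightarrow> weight (S |-| {|A|}) + Suc (size A) = weight S"
  unfolding weight_def by (simp add: sum.remove[of "fset S" A])

lemma weight_union: "weight (S |\<union>| T) \<le> weight S + weight T"
  unfolding weight_def by (simp add: sum_Un_nat)

lemma weight_less_size: "weight (options p G) < size G"
  by (cases G; cases p) (auto simp: weight_def)

lemma simplifies_size: "simplifies G K \<Longrightarrow> size K < size G"
proof (induction G arbitrary: K rule: game_induct)
  case (options G)
  then obtain p A where A: "A |\<in>| options p G" and "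
     ((\<exists>B. K = replace_opts p (options p G |-| {|A|}) G) \<or>
      (\<exists>C. C |\<in>| options (opponent p) A \<and>
         K = replace_opts p ((options p G |-| {|A|}) |\<union>| options p C) G) \<or>
      (\<exists>B. simplifies A B \<and> K = replace_opts p (finsert B (options p G |-| {|A|})) G))"
    unfolding simplifies_iff[of G K] by blast
  then consider "K = replace_opts p (options p G |-| {|A|}) G"
    | C where "C |\<in>| options (opponent p) A"
        "K = replace_opts p ((options p G |-| {|A|}) |\<union>| options p C) G"
    | B where "simplifies A B" "K = replace_opts p ({|B|} |\<union>| (options p G |-| {|A|})) G"
    by auto
  then obtain S where "K = replace_opts p S G" "weight S < weight (options p G)"
  proof cases
    case 1
    then show ?thesis
      using that weight_remove[OF A] by simp
  next
    case (2 C)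
    then show ?thesis
      using that weight_remove[OF A] weight_union[of "options p G |-| {|A|}" "options p C"]
        weight_less_size[of p C] size_option[OF 2(1)] by simp
  next
    case (3 B)
    then show ?thesis
      using that weight_remove[OF A] weight_union[of "{|B|}" "options p G |-| {|A|}"]
        options.IH[OF A 3(1)] by (simp add: weight_def)
  qed
  then show ?case
    using size_replace_opts[of p S G] by simp
qed

lemma simplifies_to_irreducible: "\<exists>K. simplifies\<^sup>*\<^sup>* G K \<and> (\<nexists>K'. simplifies K K')"
proof (induction G rule: measure_induct_rule[of size])
  case (less G)
  then show ?case
    by (metis converse_rtranclp_into_rtranclp rtranclp.rtrancl_refl simplifies_size)
qed

lemma not_simplifies_zero: "\<not> simplifies 0 K"
  by (subst simplifies_iff) simp

definition equivalent :: "game \<Rightarrow> game \<Rightarrow> bool" where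
  "equivalent T U \<longleftrightarrow> (\<forall>p. prefers p T U)"

lemma equivalent_sym: "equivalent T U \<Longrightarrow> equivalent U T"
  unfolding equivalent_def by (metis prefers_opponent)

lemma equivalent_trans: "equivalent T U \<Longrightarrow> equivalent U V \<Longrightarrow> equivalent T V"
  unfolding equivalent_def by (metis prefers_trans)

lemma equivalentI:
  assumes "prefers p T U" "prefers p U T"
  shows "equivalent T U"
  unfolding equivalent_def
proof
  fix q
  have "q = p \<or> q = opponent p"
    by (cases p; cases q) auto
  then show "prefers q T U"
    using assms by auto
qed

lemma equal_normal_iff: "equal_normal T U \<longleftrightarrow> equivalent T U"
  by (simp add: equiv_mod_iff equivalent_def prefers_iff_mod_prefers)

text \<open>Improving the options of \<open>p\<close>, and replacing those of the opponent by ones that suit \<open>p\<close> better,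
  improves a game for \<open>p\<close>.\<close>

lemma prefers_optionwise:
  assumes "\<And>A. A |\<in>| options p U \<Longrightarrow> \<exists>B. B |\<in>| options p T \<and> prefers p B A"
    and "\<And>B. B |\<in>| options (opponent p) T \<Longrightarrow> \<exists>A. A |\<in>| options (opponent p) U \<and> prefers p B A"
  shows "prefers p T U"
proof (subst prefers.simps, intro conjI ballI notI)
  fix A
  assume "A |\<in>| options p U" "prefers p A T"
  with assms(1) show False
    by (metis not_prefers_own_option prefers_trans)
next
  fix B
  assume "B |\<in>| options (opponent p) T" "prefers p U B"
  with assms(2) show False
    by (metis not_prefers_opponent_option prefers_trans)
qed

lemma equivalent_replace_opts:
  assumes "\<And>A. A |\<in>| options p T \<Longrightarrow> \<exists>B. B |\<in>| S \<and> prefers p B A"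
    and "\<And>B. B |\<in>| S \<Longrightarrow> \<exists>A. A |\<in>| options p T \<and> prefers p A B"
  shows "equivalent (replace_opts p S T) T"
  by (rule equivalentI[of p]; rule prefers_optionwise) (use assms prefers_refl in auto)

text \<open>The new game \<open>K\<close> contains the \<open>p\<close>-options of \<open>C\<close> and keeps the opponent's options of \<open>T\<close>, so \<open>p\<close>
  prefers \<open>K\<close> to \<open>C\<close>.  Hence the bypassed option \<open>A\<close>,
  from which the opponent can move to \<open>C\<close>, is still no improvement on \<open>K\<close>.  Conversely the new options
  are no improvement on \<open>C\<close>, and so none on \<open>T\<close>.\<close>

lemma equivalent_bypass:
  assumes A: "A |\<in>| options p T" and C: "C |\<in>| options (opponent p) A" and TC: "prefers p T C"
  shows "equivalent (replace_opts p ((options p T |-| {|A|}) |\<union>| options p C) T) T"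
    (is "equivalent ?K T")
proof (rule equivalentI)
  have "prefers p ?K C"
  proof (subst prefers.simps, intro conjI ballI notI)
    fix D
    assume "D |\<in>| options p C" "prefers p D ?K"
    then show False
      using not_prefers_own_option[of D p ?K] by simp
  next
    fix D
    assume "D |\<in>| options (opponent p) ?K" "prefers p C D"
    then show False
      using TC by (auto simp: prefers.simps[of p T C])
  qed
  then have "\<not> prefers p A ?K"
    using C by (auto simp: prefers.simps[of p A ?K])
  moreover have "\<not> prefers p B ?K" if "B |\<in>| options p T" "B \<noteq> A" for B
    using that not_prefers_own_option[of B p ?K] by simp
  moreover have "\<not> prefers p T B" if "B |\<in>| options (opponent p) ?K" for B
    using that not_prefers_opponent_option[of B p T] by simp
  ultimately show "prefers p ?K T"
    by (subst prefers.simps) blast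
  have "\<not> prefers p B T" if "B |\<in>| options p C" for B
    using that TC not_prefers_own_option[of B p C] prefers_trans by blast
  then have "\<not> prefers p B T" if "B |\<in>| options p ?K" for B
    using that not_prefers_own_option[of B p T] by auto
  moreover have "\<not> prefers p ?K B" if "B |\<in>| options (opponent p) T" for B
    using that not_prefers_opponent_option[of B p ?K] by simp
  ultimately show "prefers p T ?K"
    by (subst prefers.simps) blast
qed

lemma replace_opts_sprout:
  "replace_opts p (finsert 0 (sprout |`| S)) (sprout T) = sprout (replace_opts p S T)"
  by (rule game_eqI) (simp add: options_sprout)

lemma sprout_options_remove:
  "finsert 0 (sprout |`| S) |-| {|sprout A|} = finsert 0 (sprout |`| (S |-| {|A|}))"
  by (auto simp: fset_eq_iff)

lemma option_sproutE:
  assumes "A |\<in>| options p (sprout T)"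
  obtains "A = 0" | A' where "A' |\<in>| options p T" "A = sprout A'"
  using assms by (auto simp: options_sprout)

text \<open>As \<open>0\<close> is incomparable with every sprout, the option that the step removes, the option that
  dominates it and the game that it reverses through are all sprouts, so the step takes place above the
  green edge.\<close>

lemma simplifies_sprout:
  assumes "simplifies (sprout T) K"
  shows "\<exists>T'. K = sprout T' \<and> equivalent T' T"
  using assms
proof (induction T arbitrary: K rule: game_induct)
  case (options T)
  let ?G = "sprout T"
  obtain p A where A: "A |\<in>| options p ?G" and step: "
     (\<exists>B. B |\<in>| options p ?G \<and> B \<noteq> A \<and> dicot_prefers p B A \<and>
         K = replace_opts p (options p ?G |-| {|A|}) ?G) \<or>
      (\<exists>C. C |\<in>| options (opponent p) A \<and> dicot_prefers p ?G C \<and>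
         K = replace_opts p ((options p ?G |-| {|A|}) |\<union>| options p C) ?G) \<or>
      (\<exists>B. simplifies A B \<and> K = replace_opts p (finsert B (options p ?G |-| {|A|})) ?G)"
    using options.prems unfolding simplifies_iff[of ?G K] by blast
  have "A \<noteq> 0"
    using step sprout_zero_incomparable
    by (auto simp: not_simplifies_zero elim: option_sproutE)
  with A obtain A' where A': "A' |\<in>| options p T" "A = sprout A'"
    by (elim option_sproutE) auto
  let ?S = "options p T |-| {|A'|}"
  have rest: "options p ?G |-| {|A|} = finsert 0 (sprout |`| ?S)"
    by (simp add: options_sprout A'(2) sprout_options_remove)
  from step consider
      (dominated) B where "B |\<in>| options p ?G" "B \<noteq> A" "dicot_prefers p B A"
        "K = replace_opts p (options p ?G |-| {|A|}) ?G"
    | (reversible) C where "C |\<in>| options (opponent p) A" "dicot_prefers p ?G C"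
        "K = replace_opts p ((options p ?G |-| {|A|}) |\<union>| options p C) ?G"
    | (follower) B where "simplifies A B" "K = replace_opts p (finsert B (options p ?G |-| {|A|})) ?G"
    by blast
  then show ?case
  proof cases
    case (dominated B)
    from dominated(1,3) obtain B' where B': "B' |\<in>| options p T" "B = sprout B'"
      using sprout_zero_incomparable by (auto simp: A'(2) elim: option_sproutE)
    have "prefers p B' A'"
      using dominated(3) by (simp add: A'(2) B'(2) dicot_prefers_sprout_iff)
    then have "equivalent (replace_opts p ?S T) T"
      using B'(1) dominated(2) A'(2) B'(2)
      by (intro equivalent_replace_opts) (auto intro: prefers_refl)
    moreover have "K = sprout (replace_opts p ?S T)"
      by (simp add: dominated(4) rest replace_opts_sprout)
    ultimately show ?thesis
      by blast
  next
    case (reversible C)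
    from reversible(1,2) obtain C' where C': "C' |\<in>| options (opponent p) A'" "C = sprout C'"
      using sprout_zero_incomparable by (auto simp: A'(2) elim: option_sproutE)
    have "prefers p T C'"
      using reversible(2) by (simp add: C'(2) dicot_prefers_sprout_iff)
    then have "equivalent (replace_opts p (?S |\<union>| options p C') T) T"
      by (intro equivalent_bypass A'(1) C'(1))
    moreover have "K = replace_opts p (finsert 0 (sprout |`| (?S |\<union>| options p C'))) ?G"
      unfolding reversible(3) rest C'(2) options_sprout[of p C'] by (simp add: fimage_funion)
    ultimately show ?thesis
      unfolding replace_opts_sprout by blast
  next
    case (follower B)
    then obtain B' where B': "B = sprout B'" "equivalent B' A'"
      using options.IH[OF A'(1)] A'(2) by blast
    have "equivalent (replace_opts p (finsert B' ?S) T) T"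
      using B'(2) equivalent_sym[OF B'(2)] A'(1)
      by (intro equivalent_replace_opts) (auto simp: equivalent_def intro: prefers_refl)
    moreover have "K = replace_opts p (finsert 0 (sprout |`| finsert B' ?S)) ?G"
      by (simp add: follower(2) rest B'(1) finsert_commute)
    ultimately show ?thesis
      unfolding replace_opts_sprout by blast
  qed
qed

lemma simplifies_sprout_rtranclp:
  "simplifies\<^sup>*\<^sup>* (sprout T) K \<Longrightarrow> \<exists>T'. K = sprout T' \<and> equivalent T' T"
proof (induction rule: rtranclp_induct)
  case base
  show ?case
    by (intro exI[of _ T]) (simp add: equivalent_def)
next
  case (step K K')
  then show ?case
    by (metis equivalent_trans simplifies_sprout)
qed

definition reducible :: "game \<Rightarrow> bool" where
  "reducible G \<longleftrightarrow> (\<exists>K. simplifies G K)"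

lemma reducible_iff:
  "reducible G \<longleftrightarrow> (\<exists>p A. A |\<in>| options p G \<and>
     ((\<exists>B. B |\<in>| options p G \<and> B \<noteq> A \<and> dicot_prefers p B A) \<or>
      (\<exists>C. C |\<in>| options (opponent p) A \<and> dicot_prefers p G C) \<or> reducible A))"
  unfolding reducible_def simplifies_iff[of G] by blast

lemma ex_option_sprout:
  "(\<exists>B. B |\<in>| options p (sprout T) \<and> P B) \<longleftrightarrow> P 0 \<or> (\<exists>B. B |\<in>| options p T \<and> P (sprout B))"
  by (auto simp: options_sprout)

lemma not_reducible_zero: "\<not> reducible 0"
  by (simp add: reducible_def not_simplifies_zero)

text \<open>Thus \<open>*:T\<close> is irreducible exactly if \<open>T\<close> is a canonical form in normal play.\<close>

lemma reducible_sprout_iff: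
  "reducible (sprout T) \<longleftrightarrow> (\<exists>p A. A |\<in>| options p T \<and>
     ((\<exists>B. B |\<in>| options p T \<and> B \<noteq> A \<and> prefers p B A) \<or>
      (\<exists>C. C |\<in>| options (opponent p) A \<and> prefers p T C) \<or> reducible (sprout A)))"
  by (subst reducible_iff) (simp add: ex_option_sprout not_reducible_zero
      sprout_zero_incomparable dicot_prefers_sprout_iff)

text \<open>Each option \<open>A\<close> of one game is dominated by some option \<open>B\<close> of the other, as otherwise it would be
  reversible; \<open>B\<close> in turn is dominated by an option of the first game, which must be \<open>A\<close> itself, as
  otherwise \<open>A\<close> would be dominated.  So \<open>A\<close> and \<open>B\<close> are equivalent, and by induction equal.\<close>

lemma irreducible_sprouts_eq:
  assumes "\<not> reducible (sprout T)" "\<not> reducible (sprout U)" "equivalent T U"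
  shows "T = U"
  using assms
proof (induction T arbitrary: U rule: game_induct)
  case (options T)
  have match: "\<exists>B. B |\<in>| options p Y \<and> prefers p B A"
    if "A |\<in>| options p X" "\<not> reducible (sprout X)" "equivalent X Y" for A p X Y
  proof -
    have "\<not> prefers p A Y"
      using that(1,3) not_prefers_own_option prefers_trans equivalent_sym
      unfolding equivalent_def by blast
    moreover have "\<not> prefers p Y C" if "C |\<in>| options (opponent p) A" for C
      using \<open>A |\<in>| _\<close> \<open>\<not> reducible (sprout X)\<close> \<open>equivalent X Y\<close> that prefers_trans
      unfolding equivalent_def reducible_sprout_iff[of X] by blast
    ultimately show ?thesis
      by (auto simp: prefers.simps[of p A Y])
  qed
  have round_trip: "\<exists>B. B |\<in>| options p Y \<and> equivalent A B"
    if A: "A |\<in>| options p X" and X: "\<not> reducible (sprout X)" and Y: "\<not> reducible (sprout Y)"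
      and eq: "equivalent X Y" for A p X Y
  proof -
    obtain B where B: "B |\<in>| options p Y" "prefers p B A"
      using match[OF A X eq] by blast
    obtain A' where A': "A' |\<in>| options p X" "prefers p A' B"
      using match[OF B(1) Y equivalent_sym[OF eq]] by blast
    have "A' = A"
      using A A'(1) X prefers_trans[OF A'(2) B(2)] unfolding reducible_sprout_iff[of X] by blast
    then show ?thesis
      using B A'(2) equivalentI by blast
  qed
  have eq: "A = B" if "A |\<in>| options p T" "B |\<in>| options p U" "equivalent A B" for A B p
    using that options.prems options.IH[of A p B]
    unfolding reducible_sprout_iff[of T] reducible_sprout_iff[of U] by blast
  show ?case
  proof (intro game_eqI fset_eqI iffI)
    fix p A
    assume "A |\<in>| options p T"
    then show "A |\<in>| options p U"
      using round_trip[of A p T U] eq options.prems by blast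
  next
    fix p B
    assume "B |\<in>| options p U"
    then show "B |\<in>| options p T"
      using round_trip[of B p U T] eq options.prems equivalent_sym by blast
  qed
qed

text \<open>Simplification ends somewhere, and it can end only at an irreducible sprout of a game equivalent to
  \<open>T\<close>.\<close>

theorem canonical_form_sprout:
  assumes "equivalent T X" "\<not> reducible (sprout X)"
  shows "canonical_form (sprout T) K \<longleftrightarrow> K = sprout X"
proof -
  have unique: "K = sprout X" if K: "canonical_form (sprout T) K" for K
  proof -
    obtain T' where T': "K = sprout T'" "equivalent T' T"
      using K simplifies_sprout_rtranclp unfolding canonical_form_def by blast
    then have "\<not> reducible (sprout T')"
      using K by (simp add: canonical_form_def reducible_def)
    then show ?thesis
      using irreducible_sprouts_eq T' assms equivalent_trans by blast
  qed
  moreover obtain K' where "canonical_form (sprout T) K'"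
    using simplifies_to_irreducible unfolding canonical_form_def by blast
  ultimately show ?thesis
    by blast
qed

section \<open>Numbers\<close>

text \<open>Numbers measure the advantage of Left; multiplying by the sign gives the advantage of \<open>p\<close>.\<close>

fun sign :: "player \<Rightarrow> int" where
  "sign Left = 1"
| "sign Right = -1"

text \<open>A number in lowest terms \<open>m / 2^q\<close> is at distance \<open>1 / 2^q\<close> from each of its options.  The level \<open>q\<close>
  treats integers and fractions alike; only for integers can a player be without an option.\<close>

lemma number_form_level:
  assumes "number_form x X"
  obtains m :: int and q :: nat where "x = of_int m / 2 ^ q" "q = 0 \<or> odd m"
    "\<And>p. (options p X = {||} \<longleftrightarrow> q = 0 \<and> sign p * m \<le> 0)"
    "\<And>p A. A |\<in>| options p X \<Longrightarrow> options p X = {|A|} \<and> number_form (x - of_int (sign p) / 2 ^ q) A"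
  using assms
proof cases
  case 1
  then show ?thesis
    by (intro that[of 0 0]) auto
next
  case (2 n A)
  have empty: "options p X = {||} \<longleftrightarrow> sign p * int (Suc n) \<le> 0" for p
    by (cases p) (auto simp: 2)
  have opt: "options p X = {|B|} \<and> number_form (x - of_int (sign p)) B" if "B |\<in>| options p X" for p B
    using that 2 by (cases p) auto
  show ?thesis
    by (rule that[of "int (Suc n)" 0]) (use 2 empty opt in auto)
next
  case (3 n A)
  have empty: "options p X = {||} \<longleftrightarrow> sign p * (- int (Suc n)) \<le> 0" for p
    by (cases p) (auto simp: 3)
  have opt: "options p X = {|B|} \<and> number_form (x - of_int (sign p)) B" if "B |\<in>| options p X" for p B
    using that 3 by (cases p) auto
  show ?thesis
    by (rule that[of "- int (Suc n)" 0]) (use 3 empty opt in auto)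
next
  case (4 m q A B)
  have "x - 1 / 2 ^ Suc q = of_int m / 2 ^ q" "x + 1 / 2 ^ Suc q = of_int (m + 1) / 2 ^ q"
    by (simp_all add: 4 field_simps)
  then have opt: "options p X = {|C|} \<and> number_form (x - of_int (sign p) / 2 ^ Suc q) C"
    if "C |\<in>| options p X" for p C
    using that 4 by (cases p) auto
  have empty: "options p X \<noteq> {||}" for p
    by (cases p) (auto simp: 4)
  show ?thesis
  proof (rule that[of "2 * m + 1" "Suc q"])
    show "options p X = {||} \<longleftrightarrow> Suc q = 0 \<and> sign p * (2 * m + 1) \<le> 0" for p
      using empty by simp
    show "options p X = {|A|} \<and> number_form (x - of_int (sign p) / 2 ^ Suc q) A"
      if "A |\<in>| options p X" for p A
      using that by (rule opt)
  qed (simp_all add: 4)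
qed

lemma dyadic_gap:
  fixes a b :: rat
  assumes "a = of_int k / 2 ^ r" "b = of_int m / 2 ^ q" "r \<le> s" "q \<le> s" "a < b"
  shows "a + 1 / 2 ^ s \<le> b"
proof -
  have 2: "(2::rat) ^ s = 2 ^ r * 2 ^ (s - r)" "(2::rat) ^ s = 2 ^ q * 2 ^ (s - q)"
    using assms(3,4) by (simp_all flip: power_add)
  have a: "a * 2 ^ s = of_int (k * 2 ^ (s - r))"
    unfolding 2(1) by (simp add: assms(1))
  have b: "b * 2 ^ s = of_int (m * 2 ^ (s - q))"
    unfolding 2(2) by (simp add: assms(2))
  have "a * 2 ^ s < b * 2 ^ s"
    using assms(5) by simp
  then have "k * 2 ^ (s - r) + 1 \<le> m * 2 ^ (s - q)"
    unfolding a b of_int_less_iff by simp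
  then have "a * 2 ^ s + 1 \<le> b * 2 ^ s"
    unfolding a b by (metis of_int_1 of_int_add of_int_le_iff)
  then show ?thesis
    by (simp add: field_simps)
qed

text \<open>The point is that \<open>y < x\<close> excludes \<open>Y \<ge> X\<close>.  Of two different dyadic rationals, take
  one whose denominator is at least as large as that of the other.  Its options are so close to it that
  the one towards the other number, if present, does not lie beyond that number, and so it refutes
  \<open>Y \<ge> X\<close>.  It is missing only for integers, where an option of the other number serves instead.\<close>

lemma prefers_number_Left:
  "number_form x X \<Longrightarrow> number_form y Y \<Longrightarrow> prefers Left Y X \<longleftrightarrow> x \<le> y"
proof (induction "size X + size Y" arbitrary: x X y Y rule: less_induct)
  case less
  obtain m q where x: "x = of_int m / 2 ^ q" "q = 0 \<or> odd m"
    "\<And>p. (options p X = {||} \<longleftrightarrow> q = 0 \<and> sign p * m \<le> 0)"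
    "\<And>p A. A |\<in>| options p X \<Longrightarrow> options p X = {|A|} \<and> number_form (x - of_int (sign p) / 2 ^ q) A"
    using number_form_level[OF less.prems(1)] by blast
  obtain k r where y: "y = of_int k / 2 ^ r" "r = 0 \<or> odd k"
    "\<And>p. (options p Y = {||} \<longleftrightarrow> r = 0 \<and> sign p * k \<le> 0)"
    "\<And>p A. A |\<in>| options p Y \<Longrightarrow> options p Y = {|A|} \<and> number_form (y - of_int (sign p) / 2 ^ r) A"
    using number_form_level[OF less.prems(2)] by blast
  have L: "prefers Left A Y \<longleftrightarrow> y \<le> x - 1 / 2 ^ q" if "A |\<in>| options Left X" for A
    using less.hyps[of Y A y "x - 1 / 2 ^ q"] x(4)[OF that] size_option[OF that] less.prems by simp
  have R: "prefers Left X B \<longleftrightarrow> y + 1 / 2 ^ r \<le> x" if "B |\<in>| options Right Y" for B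
    using less.hyps[of B X "y + 1 / 2 ^ r" x] y(4)[OF that] size_option[OF that] less.prems by simp
  have "prefers Left Y X \<longleftrightarrow>
      (options Left X \<noteq> {||} \<longrightarrow> x - 1 / 2 ^ q < y) \<and> (options Right Y \<noteq> {||} \<longrightarrow> x < y + 1 / 2 ^ r)"
    unfolding prefers.simps[of Left Y X] using L R by (auto simp: not_le)
  also have "\<dots> \<longleftrightarrow> x \<le> y"
  proof
    assume "x \<le> y"
    moreover have "0 < (1 :: rat) / 2 ^ q" "0 < (1 :: rat) / 2 ^ r"
      by simp_all
    ultimately show "(options Left X \<noteq> {||} \<longrightarrow> x - 1 / 2 ^ q < y) \<and>
        (options Right Y \<noteq> {||} \<longrightarrow> x < y + 1 / 2 ^ r)"
      by linarith
  next
    assume gaps: "(options Left X \<noteq> {||} \<longrightarrow> x - 1 / 2 ^ q < y) \<and>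
        (options Right Y \<noteq> {||} \<longrightarrow> x < y + 1 / 2 ^ r)"
    show "x \<le> y"
    proof (rule ccontr)
      assume "\<not> x \<le> y"
      then have "y < x"
        by simp
      show False
      proof (cases "r \<le> q")
        case True
        then have "y + 1 / 2 ^ q \<le> x"
          by (intro dyadic_gap[OF y(1) x(1) _ order_refl \<open>y < x\<close>])
        then have "options Left X = {||}"
          using gaps by force
        then have "q = 0" "r = 0" "m \<le> 0"
          using x(3)[of Left] True by auto
        then have "k < m"
          using \<open>y < x\<close> x(1) y(1) by simp
        then have "options Right Y \<noteq> {||}"
          using y(3)[of Right] \<open>m \<le> 0\<close> by simp
        then have "x < y + 1"
          using gaps \<open>r = 0\<close> by simp
        then show False
          using \<open>y + 1 / 2 ^ q \<le> x\<close> \<open>q = 0\<close> by simp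
      next
        case False
        then have "y + 1 / 2 ^ r \<le> x"
          using dyadic_gap[OF y(1) x(1) order_refl _ \<open>y < x\<close>] by simp
        moreover have "options Right Y \<noteq> {||}"
          using y(3)[of Right] False by simp
        ultimately show False
          using gaps by simp
      qed
    qed
  qed
  finally show ?case .
qed

lemma prefers_number_iff:
  assumes "number_form x X" "number_form y Y"
  shows "prefers p Y X \<longleftrightarrow> of_int (sign p) * x \<le> of_int (sign p) * y"
  using prefers_number_Left[OF assms] prefers_number_Left[OF assms(2,1)] prefers_opponent[of Left Y X]
  by (cases p) auto

text \<open>The option \<open>A\<close> has a smaller level than \<open>X\<close>, so its own options are further away from it than \<open>X\<close> is: the
  opponent's move to \<open>C\<close> overshoots \<open>X\<close>.\<close>

lemma number_form_not_reversible:
  assumes "number_form x X" "A |\<in>| options p X" "C |\<in>| options (opponent p) A"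
  shows "\<not> prefers p X C"
proof -
  define s where "s = sign p"
  have s: "s = 1 \<or> s = -1" "sign (opponent p) = - s"
    by (cases p; simp add: s_def)+
  obtain m q where x: "x = of_int m / 2 ^ q" "q = 0 \<or> odd m"
    "options p X = {||} \<longleftrightarrow> q = 0 \<and> s * m \<le> 0" "number_form (x - of_int s / 2 ^ q) A"
    using number_form_level[OF assms(1)] assms(2) s_def by metis
  obtain k r where a: "x - of_int s / 2 ^ q = of_int k / 2 ^ r" "r = 0 \<or> odd k"
    "options (opponent p) A = {||} \<longleftrightarrow> r = 0 \<and> (- s) * k \<le> 0"
    "number_form ((x - of_int s / 2 ^ q) - of_int (- s) / 2 ^ r) C"
    using number_form_level[OF x(4)] assms(3) s(2) by metis
  have eq: "(m - s) * 2 ^ r = k * 2 ^ q"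
  proof -
    have "(of_int (m - s) :: rat) / 2 ^ q = of_int k / 2 ^ r"
      using a(1) by (simp add: x(1) diff_divide_distrib)
    then have "(of_int ((m - s) * 2 ^ r) :: rat) = of_int (k * 2 ^ q)"
      by (simp add: field_simps)
    then show ?thesis
      by (simp only: of_int_eq_iff)
  qed
  \<comment> \<open>For a fraction \<open>X\<close> the numerator \<open>m - s\<close> is even and cancels.  For an integer \<open>X\<close> there is nothing to
    compare: \<open>p\<close> has an option only from an integer on the side of zero that favours \<open>p\<close>, the opponent only
    from one on the other side, and a single step does not lead from one side to the other.\<close>
  have "r < q"
  proof (rule ccontr)
    assume "\<not> r < q"
    then have "(2::int) ^ r = 2 ^ (r - q) * 2 ^ q"
      by (simp flip: power_add)
    with eq have k: "(m - s) * 2 ^ (r - q) = k"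
      by simp
    show False
    proof (cases "q = 0")
      case True
      then have "r = 0"
        using k a(2) by (cases r) auto
      then have "s * m > 0" "s * k < 0" "k = m - s"
        using True x(3) a(3) assms(2,3) k by auto
      then show False
        using s(1) by auto
    next
      case False
      then have "even k"
        using k x(2) s(1) by auto
      then show False
        using a(2) False \<open>\<not> r < q\<close> by simp
    qed
  qed
  then have "(1::rat) / 2 ^ q < 1 / 2 ^ r"
    by (simp add: frac_less2)
  moreover have "of_int s * of_int s = (1 :: rat)"
    using s(1) by auto
  ultimately have "of_int s * x < of_int s * ((x - of_int s / 2 ^ q) - of_int (- s) / 2 ^ r)"
    by (simp add: algebra_simps)
  then show ?thesis
    using prefers_number_iff[OF a(4) assms(1), of p] by (simp add: s_def)
qed

theorem number_form_irreducible: "number_form x X \<Longrightarrow> \<not> reducible (sprout X)"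
proof (induction X arbitrary: x rule: game_induct)
  case (options X)
  show ?case
  proof
    assume "reducible (sprout X)"
    then obtain p A where A: "A |\<in>| options p X" and
      "(\<exists>B. B |\<in>| options p X \<and> B \<noteq> A) \<or>
       (\<exists>C. C |\<in>| options (opponent p) A \<and> prefers p X C) \<or> reducible (sprout A)"
      unfolding reducible_sprout_iff[of X] by blast
    moreover have "options p X = {|A|}" "\<exists>a. number_form a A"
      using number_form_level[OF options.prems] A by metis+
    ultimately show False
      using options number_form_not_reversible by auto
  qed
qed

text \<open>The new number lies in the direction that favours \<open>p\<close>: an integer moves by \<open>1\<close> away from zero or by
  \<open>1/2\<close> towards zero, and a fraction moves halfway towards its option for the opponent.\<close>

lemma number_form_extend:
  assumes "number_form x X"
  shows "\<exists>y. number_form y (replace_opts p {|X|} X)"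
  using assms
proof cases
  case 1
  then show ?thesis
    using number_form.intros(2)[of 0 0] number_form.intros(3)[of 0 0] number_form.intros(1)
    by (cases p) (auto simp: zero_game_def)
next
  case (2 n A)
  then show ?thesis
    using number_form.intros(2)[of "Suc n" X] number_form.intros(4)[of "int n" 0 A X] assms
    by (cases p) (auto simp: add.commute)
next
  case (3 n A)
  then show ?thesis
    using number_form.intros(3)[of "Suc n" X] number_form.intros(4)[of "- int (Suc n)" 0 X A] assms
    by (cases p) auto
next
  case (4 m q A B)
  have "of_int (2 * m) / 2 ^ Suc q = (of_int m / 2 ^ q :: rat)"
    "of_int (2 * m + 1 + 1) / 2 ^ Suc q = (of_int (m + 1) / 2 ^ q :: rat)"
    by (simp_all add: field_simps)
  then show ?thesis
    using number_form.intros(4)[of "2 * m + 1" "Suc q" X B] number_form.intros(4)[of "2 * m" "Suc q" A X] 4 assms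
    by (cases p) auto
qed

section \<open>Hackenbush Strings and Sprigs\<close>

fun edge :: "player \<Rightarrow> colour" where
  "edge Left = Blue"
| "edge Right = Red"

lemma options_string_game:
  "options p (string_game s) = fset_of_list
     (map (\<lambda>i. string_game (take i s)) (filter (\<lambda>i. s ! i \<in> {edge p, Green}) [0..<length s]))"
  by (cases p; subst string_game.simps) auto

lemma string_game_Nil [simp]: "string_game [] = 0"
  by (rule game_eqI) (simp add: options_string_game)

lemma options_string_game_snoc:
  "options p (string_game (s @ [c])) =
     (if c \<in> {edge p, Green} then finsert (string_game s) (options p (string_game s))
      else options p (string_game s))"
proof -
  have "filter (\<lambda>i. (s @ [c]) ! i \<in> {edge p, Green}) [0..<length s] =
      filter (\<lambda>i. s ! i \<in> {edge p, Green}) [0..<length s]"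
    by (intro filter_cong) (auto simp: nth_append)
  moreover have "map (\<lambda>i. string_game (take i (s @ [c]))) (filter P [0..<length s]) =
      map (\<lambda>i. string_game (take i s)) (filter P [0..<length s])" for P
    by (intro map_cong) auto
  ultimately show ?thesis
    by (auto simp: options_string_game fset_of_list_elem fset_eq_iff)
qed

text \<open>Building a String edge by edge from the ground adds the String built so far as a new option, and the
  sprout of a String grows in the same way.\<close>

lemma string_game_Green_Cons: "string_game (Green # t) = sprout (string_game t)"
proof (induction t rule: rev_induct)
  case Nil
  have "string_game ([] @ [Green]) = star"
    by (rule game_eqI) (simp only: options_string_game_snoc, simp)
  then show ?case
    by simp
next
  case (snoc c t)
  have "string_game ((Green # t) @ [c]) = sprout (string_game (t @ [c]))"
    by (rule game_eqI)
      (auto simp only: options_string_game_snoc options_sprout snoc fimage_finsert finsert_commute split: if_splits)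
  then show ?case
    by simp
qed

text \<open>The best options of \<open>T\<close> and \<open>X\<close> agree.  This is more than equivalence, and the extra information is
  what carries the induction along a String: a new edge on top keeps the options of the String below.\<close>

definition cofinal :: "game \<Rightarrow> game \<Rightarrow> bool" where
  "cofinal T X \<longleftrightarrow> (\<forall>p.
     (\<forall>A. A |\<in>| options p T \<longrightarrow> (\<exists>B. B |\<in>| options p X \<and> prefers p B A)) \<and>
     (\<forall>B. B |\<in>| options p X \<longrightarrow> (\<exists>A. A |\<in>| options p T \<and> prefers p A B)))"

lemma cofinal_imp_equivalent:
  assumes "cofinal T X"
  shows "equivalent T X"
  unfolding equivalent_def
proof
  fix p
  have "prefers p B A \<longleftrightarrow> prefers (opponent p) A B" for A B
    by simp
  then show "prefers p T X"
    using assms unfolding cofinal_def by (intro prefers_optionwise) blast+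
qed

text \<open>A new top edge belonging to \<open>p\<close> gives \<open>p\<close> the option to remove just that edge.  It dominates the older
  options of \<open>p\<close>, since these are dominated by the options of the number \<open>X\<close>, which are worse for \<open>p\<close> than
  \<open>X\<close>.\<close>

lemma red_blue_string_number:
  "red_blue s \<Longrightarrow> \<exists>x X. number_form x X \<and> cofinal (string_game s) X"
proof (induction s rule: rev_induct)
  case Nil
  show ?case
    using number_form.intros(1) by (intro exI[of _ 0]) (auto simp: cofinal_def)
next
  case (snoc c s)
  let ?T = "string_game s"
  obtain x X where X: "number_form x X" "cofinal ?T X"
    using snoc by (auto simp: red_blue_def)
  obtain p where p: "c = edge p"
    using snoc.prems by (auto simp: red_blue_def intro: that[of Left] that[of Right])
  let ?X = "replace_opts p {|X|} X"
  obtain y where y: "number_form y ?X"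
    using number_form_extend[OF X(1)] by blast
  have c: "c \<in> {edge q, Green} \<longleftrightarrow> q = p" for q
    by (cases p; cases q) (auto simp: p)
  have eq: "prefers q ?T X" "prefers q X ?T" for q
    using cofinal_imp_equivalent[OF X(2)] equivalent_sym unfolding equivalent_def by blast+
  have below: "prefers p X B" if "B |\<in>| options p X" for B
  proof -
    have "\<exists>n. number_form (x - of_int (sign p) / 2 ^ n) B"
      by (rule number_form_level[OF X(1)]) (use that in blast)
    then show ?thesis
      using prefers_number_iff[OF _ X(1)] by (cases p) auto
  qed
  have "cofinal (string_game (s @ [c])) ?X"
    unfolding cofinal_def
  proof (intro allI conjI impI)
    fix q A
    assume A: "A |\<in>| options q (string_game (s @ [c]))"
    show "\<exists>B. B |\<in>| options q ?X \<and> prefers q B A"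
    proof (cases "q = p \<and> A = ?T")
      case True
      then show ?thesis
        using eq by auto
    next
      case False
      then have "A |\<in>| options q ?T"
        using A c by (auto simp only: options_string_game_snoc split: if_splits)
      then obtain B where "B |\<in>| options q X" "prefers q B A"
        using X(2) unfolding cofinal_def by blast
      then show ?thesis
        using prefers_trans[OF below, of B A] by (cases "q = p") auto
    qed
  next
    fix q B
    assume B: "B |\<in>| options q ?X"
    show "\<exists>A. A |\<in>| options q (string_game (s @ [c])) \<and> prefers q A B"
    proof (cases "q = p")
      case True
      then show ?thesis
        using B c eq by (auto simp only: options_string_game_snoc options_replace_opts) auto
    next
      case False
      then show ?thesis
        using B c X(2) unfolding cofinal_def
        by (simp only: options_string_game_snoc options_replace_opts) auto
    qed
  qed
  with y show ?case
    by blast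
qed

lemma normal_value_iff: "normal_value T x \<longleftrightarrow> (\<exists>X. number_form x X \<and> equivalent T X)"
  by (simp add: normal_value_def equal_normal_iff)

lemma number_form_equivalent_iff:
  assumes "number_form x X" "number_form y Y"
  shows "equivalent X Y \<longleftrightarrow> x = y"
proof
  assume "equivalent X Y"
  then show "x = y"
    using prefers_number_Left[OF assms] prefers_number_Left[OF assms(2,1)] equivalent_sym
    unfolding equivalent_def by (meson order_antisym)
next
  assume "x = y"
  then show "equivalent X Y"
    using assms by (simp add: equivalent_def prefers_number_iff)
qed

theorem theorem2p9:
  fixes s :: "colour list"
  assumes "sprig s"
  shows "(\<exists>!x. normal_value (string_game (red_blue_part s)) x) \<and>
    (\<forall>x X. normal_value (string_game (red_blue_part s)) x \<longrightarrow> number_form x X \<longrightarrow>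
       (\<forall>K. canonical_form (string_game s) K \<longleftrightarrow> K = ordinal_sum star X))"
proof -
  obtain t where t: "s = Green # t" "red_blue t"
    using assms by (auto simp: sprig_def)
  have "\<exists>x. normal_value (string_game t) x"
    using red_blue_string_number[OF t(2)] cofinal_imp_equivalent by (auto simp: normal_value_iff)
  moreover have "x = y" if "normal_value (string_game t) x" "normal_value (string_game t) y" for x y
    using that number_form_equivalent_iff equivalent_sym equivalent_trans
    unfolding normal_value_iff by blast
  moreover have "canonical_form (sprout (string_game t)) K \<longleftrightarrow> K = sprout X"
    if "normal_value (string_game t) x" "number_form x X" for x X K
  proof (rule canonical_form_sprout)
    obtain Y where "number_form x Y" "equivalent (string_game t) Y"
      using \<open>normal_value _ x\<close> by (auto simp: normal_value_iff)
    then show "equivalent (string_game t) X"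
      using \<open>number_form x X\<close> number_form_equivalent_iff equivalent_trans by blast
    show "\<not> reducible (sprout X)"
      using \<open>number_form x X\<close> by (rule number_form_irreducible)
  qed
  ultimately show ?thesis
    by (auto simp: red_blue_part_def t(1) string_game_Green_Cons)
qed

end
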